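(* Let $G$ be a group whose order is a product of two or more distinct primes, each with multiplicity one; that is, $|G|=p_1p_2\cdots p_n$ with $n\geq 2$ and each $p_i$ prime, where $p_i=p_j$ only when $i=j$. Then $G$ does not have an equal covering.
   Context: A covering of a group $G$ is a collection of proper subgroups of $G$ whose set-theoretic union is $G$. An equal covering of $G$ is a covering of $G$ all of whose members have the same order. *)

theory Defs
  imports
    "HOL-Algebra.Coset"
    "HOL-Library.Equipollence"
    "HOL-Computational_Algebra.Primes"
begin

definition proper_subgroup :: "'a set \<Rightarrow> ('a, 'b) monoid_scheme \<Rightarrow> bool"
  where "proper_subgroup H G \<longleftrightarrow> subgroup H G \<and> H \<noteq> carrier G"

definition group_covering :: "('a, 'b) monoid_scheme \<Rightarrow> 'a set set \<Rightarrow> bool"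
  where "group_covering G \<C> \<longleftrightarrow> (\<forall>H\<in>\<C>. proper_subgroup H G) \<and> \<Union>\<C> = carrier G"

(* Equality of orders is stated by equipollence, since card is 0 on every infinite set;
   for members of a covering of a finite group it says that their card agrees. *)
definition equal_covering :: "('a, 'b) monoid_scheme \<Rightarrow> 'a set set \<Rightarrow> bool"
  where "equal_covering G \<C> \<longleftrightarrow> group_covering G \<C> \<and> (\<forall>H\<in>\<C>. \<forall>K\<in>\<C>. H \<approx> K)"

end

(* If H is a member of an equal covering, some prime q divides the index of H, and hence not
   the order of H, because the order of G is squarefree. But a generator of a Sylow q-subgroup
   lies in some member of the covering, so q divides the common order of the members. *)
theory Submission
  imports Defs "HOL-Algebra.Sylow" "HOL-Computational_Algebra.Squarefree"
begin

text \<open>Lagrange's theorem with \<open>J\<close> as the ambient group.\<close>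

lemma (in group) card_subgroup_dvd_card:
  assumes "subgroup I G" "subgroup J G" "I \<subseteq> J"
  shows "card I dvd card J"
proof -
  interpret J: group "G\<lparr>carrier := J\<rparr>"
    using assms(2) by (rule subgroup_imp_group)
  have "card (rcosets\<^bsub>G\<lparr>carrier := J\<rparr>\<^esub> I) * card I = order (G\<lparr>carrier := J\<rparr>)"
    by (intro J.lagrange subgroup_incl assms)
  then have "card I dvd order (G\<lparr>carrier := J\<rparr>)"
    by (metis dvd_triv_right)
  then show ?thesis
    by (simp add: order_def)
qed

lemma (in group) prime_dvd_card_covering_member:
  assumes fin: "finite (carrier G)" and q: "prime q" and dvd: "q dvd order G"
    and cov: "group_covering G \<C>"
  obtains H where "H \<in> \<C>" "q dvd card H"
proof -
  \<comment> \<open>With exponent 1, Sylow's theorem becomes Cauchy's: \<open>q\<close> may still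
    divide \<open>m\<close>.\<close>
  obtain m where "order G = q ^ 1 * m"
    using dvd by auto
  then obtain P where P: "subgroup P G" "card P = q"
    using sylow_thm[OF q is_group _ fin, of 1 m] by auto
  have "P \<noteq> {\<one>}"
    using P(2) q by auto
  then obtain x where x: "x \<in> P" "x \<noteq> \<one>"
    using subgroup.one_closed[OF P(1)] by blast
  then have "x \<in> \<Union>\<C>"
    using subgroup.mem_carrier[OF P(1)] cov by (simp add: group_covering_def)
  then obtain H where H: "H \<in> \<C>" "x \<in> H"
    by blast
  then have sub: "subgroup H G"
    using cov by (simp add: group_covering_def proper_subgroup_def)
  \<comment> \<open>Intersecting replaces the argument that \<open>x\<close> generates
    \<open>P\<close>: \<open>H \<inter> P\<close> contains both \<open>x\<close> and
    \<open>\<one>\<close>, and its order divides the prime \<open>q\<close>, so that order is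
    \<open>q\<close>.\<close>
  have sub': "subgroup (H \<inter> P) G"
    by (rule subgroups_Inter_pair[OF sub P(1)])
  have "card (H \<inter> P) \<noteq> 1"
    using x H(2) subgroup.one_closed[OF sub'] by (metis IntI One_nat_def card_1_singleton_iff singletonD x(1))
  moreover have "card (H \<inter> P) dvd q"
    using card_subgroup_dvd_card[OF sub' P(1)] P(2) by simp
  ultimately have "card (H \<inter> P) = q"
    using q prime_nat_iff by blast
  then have "q dvd card H"
    using card_subgroup_dvd_card[OF sub' sub] by simp
  with H(1) show ?thesis
    by (rule that)
qed

lemma (in group) no_equal_covering_if_squarefree_order:
  assumes sqf: "squarefree (order G)"
  shows "\<not> equal_covering G \<C>"
proof
  assume eq: "equal_covering G \<C>"
  then have cov: "group_covering G \<C>"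
    by (simp add: equal_covering_def)
  \<comment> \<open>An infinite carrier has \<open>order\<close> 0, and 0 is not squarefree, so the
    hypothesis forces \<open>G\<close> to be finite.\<close>
  have pos: "order G > 0"
    using sqf by (auto intro: gr0I)
  then have fin: "finite (carrier G)"
    using order_gt_0_iff_finite by blast
  \<comment> \<open>The covering is nonempty because some member must contain
    \<open>\<one>\<close>.\<close>
  from cov obtain H where H: "H \<in> \<C>"
    unfolding group_covering_def by (metis Union_iff one_closed)
  then have sub: "subgroup H G" and ne: "H \<noteq> carrier G"
    using cov by (auto simp: group_covering_def proper_subgroup_def)
  define k where "k = card (rcosets H)"
  have N: "k * card H = order G"
    unfolding k_def using sub by (rule lagrange)
  have "card H < order G"
    unfolding order_def using fin ne subgroup.subset[OF sub] by (intro psubset_card_mono) auto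
  with N have "k \<noteq> 1"
    by auto
  then obtain q where q: "prime q" "q dvd k"
    using prime_factor_nat by blast
  have "q dvd order G"
    using q(2) N by (metis dvd_mult2)
  then obtain K where K: "K \<in> \<C>" "q dvd card K"
    using prime_dvd_card_covering_member[OF fin q(1) _ cov] by blast
  have "K \<approx> H"
    using eq K(1) H by (simp add: equal_covering_def)
  then have "card K = card H"
    using bij_betw_same_card by (auto simp: eqpoll_def)
  \<comment> \<open>One factor \<open>q\<close> comes from the index \<open>k\<close> of
    \<open>H\<close>, the other from \<open>card K\<close>, which equals
    \<open>card H\<close>.\<close>
  then have "q ^ 2 dvd order G"
    using mult_dvd_mono[OF q(2) K(2)] N by (simp add: power2_eq_square)
  then show False
    using squarefreeD[OF sqf] q(1) not_prime_unit by blast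
qed

theorem theorem18:
  fixes G :: "('a, 'b) monoid_scheme" and p :: "nat \<Rightarrow> nat" and n :: nat
  assumes "group G"
    and "n \<ge> 2"
    and "\<And>i. i \<in> {1..n} \<Longrightarrow> prime (p i)"
    and "inj_on p {1..n}"
    and "order G = (\<Prod>i = 1..n. p i)"
  shows "\<nexists>\<C>. equal_covering G \<C>"
proof -
  \<comment> \<open>Injectivity of \<open>p\<close> makes the prime factors pairwise distinct, hence
    pairwise coprime.\<close>
  have "squarefree (\<Prod>i = 1..n. p i)"
    using assms(3,4)
    by (intro squarefree_prod_coprime primes_coprime squarefree_prime) (auto dest: inj_onD)
  then show ?thesis
    using group.no_equal_covering_if_squarefree_order[OF assms(1)] assms(5) by metis
qed

end
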